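(* Let $\mathcal{L}\leq\operatorname{Aut}\mathcal{T}_2$ be the lamplighter group, realized as the group generated by $a=(a,a\sigma)$ and $\sigma$, where $\sigma$ is the rooted automorphism of the binary tree $\mathcal{T}_2$ corresponding to $(1\,2)$. Then: $\mathcal{L}\leq\Gamma=\operatorname{Aut}\mathcal{T}_2$; $|\mathcal{L}:\mathcal{L}'|=\infty$; $\mathcal{L}$ is fractal; $|\mathcal{L}':\mathrm{st}_{\mathcal{L}}(1)'|$ is finite; and $L(\mathcal{L})\neq 1$.
   Context: Automorphisms act on the right. For a group $G$, $G'$ is the derived subgroup, $[x,y]=x^{-1}y^{-1}xy$, $[x,_1y]=[x,y]$, $[x,_ny]=[[x,_{n-1}y],y]$ for $n\ge 2$. An element $g\in G$ is left Engel if for every $x\in G$ there is $n=n(g,x)\ge1$ with $[x,_ng]=1$; $L(G)$ denotes the set of left Engel elements of $G$. $\mathcal{T}_2$ is the rooted binary tree; $\mathrm{st}(1)$ is the subgroup of $\operatorname{Aut}\mathcal{T}_2$ fixing both first-level vertices, and $\mathrm{st}_G(1)=\mathrm{st}(1)\cap G$. $\psi:\mathrm{st}(1)\to\operatorname{Aut}\mathcal{T}_2\times\operatorname{Aut}\mathcal{T}_2$ is the isomorphism sending $g$ to the pair of its sections at the first-level vertices (its actions on the two subtrees hanging from them, identified with $\mathcal{T}_2$). The rooted automorphism $\sigma$ rigidly swaps these two subtrees. The notation $(g_1,g_2)$ means $\psi^{-1}(g_1,g_2)$. Every $g\in\operatorname{Aut}\mathcal{T}_2$ is uniquely $g=g_0\tau$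 with $g_0\in\mathrm{st}(1)$, $\tau\in\{1,\sigma\}$; $G\le\operatorname{Aut}\mathcal{T}_2$ is self-similar if $\psi(g_0)\in G\times G$ for all $g=g_0\tau\in G$, and it is fractal if moreover both projections of $\psi(\mathrm{st}_G(1))$ to $G$ are onto. $\Gamma\le \operatorname{Aut}\mathcal{T}_p$ denotes the group of automorphisms whose local permutation at each vertex is a power of $(1\,2\,\dots\,p)$ (standard Sylow pro-$p$ subgroup); for $p=2$ it equals $\operatorname{Aut}\mathcal{T}_2$. The lamplighter group is the restricted wreath product $C_2\wr C_\infty$; it is well known that it is isomorphic to the group $\langle a,\sigma\rangle$ above. *)

theory Defs
  imports "HOL-Algebra.Coset" "HOL-Algebra.Generated_Groups"
begin

section \<open>Automorphisms of the rooted binary tree\<close>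

text \<open>
  The vertices of the rooted binary tree are the finite words over a two-letter alphabet, the root
  is the empty word, and the letters \<open>1\<close>, \<open>2\<close> of the first level are \<open>False\<close>, \<open>True\<close>. In particular
  the permutation \<open>(1 2)\<close> is \<^const>\<open>Not\<close>.
\<close>

type_synonym vertex = "bool list"

definition tree_adj :: "vertex \<Rightarrow> vertex \<Rightarrow> bool" where
  "tree_adj u v \<longleftrightarrow> (\<exists>x. v = u @ [x]) \<or> (\<exists>x. u = v @ [x])"

text \<open>
  Automorphisms act on the right, so the product of \<open>g\<close> and \<open>h\<close> is \<open>g\<close> followed by \<open>h\<close>.
\<close>

definition AutT :: "(vertex \<Rightarrow> vertex) monoid" where
  "AutT = \<lparr>carrier = {g. bij g \<and> g [] = [] \<and> (\<forall>u v. tree_adj (g u) (g v) \<longleftrightarrow> tree_adj u v)},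
           mult = (\<lambda>g h. h \<circ> g),
           one = id\<rparr>"

definition st1 :: "(vertex \<Rightarrow> vertex) set" where
  "st1 = {g \<in> carrier AutT. g [False] = [False] \<and> g [True] = [True]}"

text \<open>
  An automorphism \<open>g\<close> maps the subtree below \<open>v\<close> onto the subtree below \<open>g v\<close>, which lies on the same
  level; the section of \<open>g\<close> at \<open>v\<close> is the induced map after both are identified with the whole tree.
\<close>

definition sect_at :: "(vertex \<Rightarrow> vertex) \<Rightarrow> vertex \<Rightarrow> vertex \<Rightarrow> vertex" where
  "sect_at g v w = drop (length v) (g (v @ w))"

text \<open>Only used for arguments in \<^const>\<open>st1\<close>.\<close>

definition psi :: "(vertex \<Rightarrow> vertex) \<Rightarrow> (vertex \<Rightarrow> vertex) \<times> (vertex \<Rightarrow> vertex)" where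
  "psi g = (sect_at g [False], sect_at g [True])"

definition local_perm :: "(vertex \<Rightarrow> vertex) \<Rightarrow> vertex \<Rightarrow> bool \<Rightarrow> bool" where
  "local_perm g v x = last (g (v @ [x]))"

definition Gamma :: "(vertex \<Rightarrow> vertex) set" where
  "Gamma = {g \<in> carrier AutT. \<forall>v. \<exists>k::nat. local_perm g v = Not ^^ k}"

fun sigma :: "vertex \<Rightarrow> vertex" where
  "sigma [] = []"
| "sigma (x # w) = (\<not> x) # w"

definition self_similar :: "(vertex \<Rightarrow> vertex) set \<Rightarrow> bool" where
  "self_similar G \<longleftrightarrow> subgroup G AutT \<and>
     (\<forall>g \<in> G. \<forall>g0 \<in> st1. \<forall>\<tau> \<in> {\<one>\<^bsub>AutT\<^esub>, sigma}. g = g0 \<otimes>\<^bsub>AutT\<^esub> \<tau> \<longrightarrow> psi g0 \<in> G \<times> G)"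

definition fractal :: "(vertex \<Rightarrow> vertex) set \<Rightarrow> bool" where
  "fractal G \<longleftrightarrow> self_similar G \<and>
     fst ` psi ` (st1 \<inter> G) = G \<and> snd ` psi ` (st1 \<inter> G) = G"


section \<open>Left Engel elements\<close>

definition commutator :: "('a, 'b) monoid_scheme \<Rightarrow> 'a \<Rightarrow> 'a \<Rightarrow> 'a" where
  "commutator G x y = inv\<^bsub>G\<^esub> x \<otimes>\<^bsub>G\<^esub> inv\<^bsub>G\<^esub> y \<otimes>\<^bsub>G\<^esub> x \<otimes>\<^bsub>G\<^esub> y"

text \<open>
  The library's \<^const>\<open>derived\<close> is generated by the elements \<open>x y x\<inverse> y\<inverse>\<close>; on a subgroup these
  are the same elements as the commutators \<open>x\<inverse> y\<inverse> x y\<close>.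
\<close>

text \<open>\<open>engel_comm G x y n\<close> is \<open>[x, y, \<dots>, y]\<close> with \<open>n\<close> entries \<open>y\<close>.\<close>

primrec engel_comm :: "('a, 'b) monoid_scheme \<Rightarrow> 'a \<Rightarrow> 'a \<Rightarrow> nat \<Rightarrow> 'a" where
  "engel_comm G x y 0 = x"
| "engel_comm G x y (Suc n) = commutator G (engel_comm G x y n) y"

definition left_engel :: "('a, 'b) monoid_scheme \<Rightarrow> 'a set" where
  "left_engel G =
     {g \<in> carrier G. \<forall>x \<in> carrier G. \<exists>n\<ge>1. engel_comm G x g n = \<one>\<^bsub>G\<^esub>}"


section \<open>The lamplighter group\<close>

text \<open>
  The recursion unfolds \<open>a = (a, a\<sigma>)\<close>; see \<open>psi_gen_a\<close> and \<open>gen_a_unique\<close> below. As the action is on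
  the right, \<open>a\<sigma>\<close> applies \<open>a\<close> first.
\<close>

fun gen_a :: "vertex \<Rightarrow> vertex" where
  "gen_a [] = []"
| "gen_a (False # w) = False # gen_a w"
| "gen_a (True # w) = True # sigma (gen_a w)"

definition lamplighter :: "(vertex \<Rightarrow> vertex) set" where
  "lamplighter = generate AutT {gen_a, sigma}"


section \<open>Consistency of the definitions\<close>

lemma AutT_mult [simp]: "g \<otimes>\<^bsub>AutT\<^esub> h = h \<circ> g"
  by (simp add: AutT_def)

lemma AutT_one [simp]: "\<one>\<^bsub>AutT\<^esub> = id"
  by (simp add: AutT_def)

lemma AutT_group: "group AutT"
proof (rule groupI)
  fix g assume g: "g \<in> carrier AutT"
  then have b: "bij g" and r: "g [] = []"
    and e: "\<And>u v. tree_adj (g u) (g v) \<longleftrightarrow> tree_adj u v"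
    by (auto simp: AutT_def)
  have "tree_adj (inv_into UNIV g u) (inv_into UNIV g v) \<longleftrightarrow> tree_adj u v" for u v
    using e[of "inv_into UNIV g u" "inv_into UNIV g v"] b
    by (simp add: bij_is_surj surj_f_inv_f)
  moreover have "inv_into UNIV g [] = []"
    using b r by (metis bij_inv_eq_iff)
  ultimately have "inv_into UNIV g \<in> carrier AutT"
    using b by (simp add: AutT_def bij_imp_bij_inv)
  moreover have "inv_into UNIV g \<otimes>\<^bsub>AutT\<^esub> g = \<one>\<^bsub>AutT\<^esub>"
    using b by (simp add: fun_eq_iff bij_is_surj surj_f_inv_f)
  ultimately show "\<exists>h \<in> carrier AutT. h \<otimes>\<^bsub>AutT\<^esub> g = \<one>\<^bsub>AutT\<^esub>" by blast
qed (auto simp: AutT_def bij_comp o_assoc)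

lemma AutT_adj: "g \<in> carrier AutT \<Longrightarrow> tree_adj (g u) (g v) \<longleftrightarrow> tree_adj u v"
  by (simp add: AutT_def)

lemma AutT_snoc:
  assumes "g \<in> carrier AutT"
  shows "\<exists>y. g (v @ [x]) = g v @ [y]"
proof (induction v arbitrary: x rule: rev_induct)
  case Nil
  have "tree_adj [] [x]" by (simp add: tree_adj_def)
  then have "tree_adj (g []) (g [x])" and "g [] = []"
    using AutT_adj[OF assms] assms by (blast, simp add: AutT_def)
  then show ?case by (auto simp: tree_adj_def)
next
  case (snoc z u)
  have "tree_adj (u @ [z]) ((u @ [z]) @ [x])" by (simp add: tree_adj_def)
  then have "tree_adj (g (u @ [z])) (g ((u @ [z]) @ [x]))"
    using AutT_adj[OF assms] by blast
  moreover have "g (u @ [z]) \<noteq> g ((u @ [z]) @ [x]) @ [y]" for y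
  proof
    assume *: "g (u @ [z]) = g ((u @ [z]) @ [x]) @ [y]"
    obtain y' where "g (u @ [z]) = g u @ [y']" using snoc.IH by blast
    with * have "g u = g ((u @ [z]) @ [x])" by simp
    then have "u = (u @ [z]) @ [x]"
      using assms by (auto simp: AutT_def dest: bij_is_inj injD)
    then show False by simp
  qed
  ultimately show ?case by (auto simp: tree_adj_def)
qed

lemma AutT_length:
  assumes "g \<in> carrier AutT"
  shows "length (g v) = length v"
proof (induction v rule: rev_induct)
  case Nil
  show ?case using assms by (simp add: AutT_def)
next
  case (snoc x u)
  then show ?case using AutT_snoc[OF assms, of u x] by auto
qed

lemma AutT_append:
  assumes "g \<in> carrier AutT"
  shows "g (v @ w) = g v @ sect_at g v w"
proof -
  have "\<exists>w'. g (v @ w) = g v @ w'"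
  proof (induction w rule: rev_induct)
    case (snoc x u)
    then show ?case using AutT_snoc[OF assms, of "v @ u" x] by auto
  qed simp
  then show ?thesis
    by (auto simp: sect_at_def AutT_length[OF assms, of v, symmetric])
qed

lemma AutT_I:
  assumes b: "bij g" and r: "g [] = []" and s: "\<And>v x. \<exists>y. g (v @ [x]) = g v @ [y]"
  shows "g \<in> carrier AutT"
proof -
  have len: "length (g v) = length v" for v
  proof (induction v rule: rev_induct)
    case (snoc x u)
    then show ?case using s[of u x] by auto
  qed (simp add: r)
  have *: "\<exists>x. v = u @ [x]" if "g v = g u @ [y]" for u v y
  proof -
    from that have "length v = Suc (length u)" by (metis len length_append_singleton)
    then obtain u' x where v: "v = u' @ [x]" by (metis length_Suc_conv_rev)
    obtain y' where "g v = g u' @ [y']" using s v by blast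
    with that have "g u' = g u" by simp
    then show ?thesis using b v by (metis bij_is_inj injD)
  qed
  have "tree_adj (g u) (g v) \<longleftrightarrow> tree_adj u v" for u v
    unfolding tree_adj_def using s * by blast
  then show ?thesis using b r by (simp add: AutT_def)
qed

lemma sigma_sigma [simp]: "sigma (sigma w) = w"
  by (cases w) auto

lemma length_sigma [simp]: "length (sigma w) = length w"
  by (cases w) auto

lemma sigma_snoc: "\<exists>y. sigma (v @ [x]) = sigma v @ [y]"
  by (cases v) auto

lemma sigma_AutT: "sigma \<in> carrier AutT"
proof (rule AutT_I)
  show "bij sigma" by (rule involuntory_imp_bij) simp
qed (auto intro: sigma_snoc)

lemma sigma_inject [simp]: "sigma u = sigma v \<longleftrightarrow> u = v"
  by (metis sigma_sigma)

lemma gen_a_Nil_iff [simp]: "gen_a w = [] \<longleftrightarrow> w = []"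
  by (cases w rule: gen_a.cases) auto

lemma gen_a_AutT: "gen_a \<in> carrier AutT"
proof (rule AutT_I)
  have "gen_a u = gen_a v \<Longrightarrow> u = v" for u v
  proof (induction u arbitrary: v rule: gen_a.induct)
    case 1
    then show ?case by (cases v rule: gen_a.cases) auto
  next
    case (2 w)
    then show ?case by (cases v rule: gen_a.cases) auto
  next
    case (3 w)
    then show ?case by (cases v rule: gen_a.cases) auto
  qed
  moreover have "\<exists>v. gen_a v = w" for w
  proof (induction w rule: length_induct)
    case (1 w)
    show ?case
    proof (cases w)
      case Nil
      then show ?thesis by auto
    next
      case (Cons x u)
      obtain v v' where "gen_a v = u" "gen_a v' = sigma u"
        using 1 Cons by (metis length_Cons length_sigma lessI)
      then have "gen_a (x # (if x then v' else v)) = w"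
        using Cons by (cases x) auto
      then show ?thesis by blast
    qed
  qed
  ultimately show "bij gen_a" by (metis bij_def injI surjI)
next
  show "\<exists>y. gen_a (v @ [x]) = gen_a v @ [y]" for v x
  proof (induction v rule: gen_a.induct)
    case 1
    then show ?case by (cases x) auto
  next
    case (2 w)
    then show ?case by auto
  next
    case (3 w)
    then obtain y where "gen_a (w @ [x]) = gen_a w @ [y]" by blast
    then show ?case using sigma_snoc by simp
  qed
qed simp

lemma gen_a_st1: "gen_a \<in> st1"
  by (simp add: st1_def gen_a_AutT)

lemma psi_gen_a: "psi gen_a = (gen_a, gen_a \<otimes>\<^bsub>AutT\<^esub> sigma)"
  by (simp add: psi_def sect_at_def fun_eq_iff)

lemma gen_a_unique:
  assumes g: "g \<in> st1" and eq: "psi g = (g, g \<otimes>\<^bsub>AutT\<^esub> sigma)"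
  shows "g = gen_a"
proof
  have A: "g \<in> carrier AutT" and f: "g [False] = [False]" and t: "g [True] = [True]"
    using g by (auto simp: st1_def)
  have "sect_at g [False] = g" and "sect_at g [True] = sigma \<circ> g"
    using eq by (simp_all add: psi_def)
  then have F: "g (False # w) = False # g w" and T: "g (True # w) = True # sigma (g w)" for w
    using AutT_append[OF A, of "[False]" w] AutT_append[OF A, of "[True]" w] f t by simp_all
  show "g w = gen_a w" for w
    by (induction w rule: gen_a.induct) (use A in \<open>auto simp: F T AutT_def\<close>)
qed

lemma lamplighter_subgroup: "subgroup lamplighter AutT"
  unfolding lamplighter_def
  by (rule group.generate_is_subgroup[OF AutT_group]) (simp add: gen_a_AutT sigma_AutT)

end

theory Submission
  imports Defs
begin

text \<open>
  Read a word \<open>w\<close> as the truncation of a power series over the field with two elements, the first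
  letter being the constant coefficient. Then \<open>sigma\<close> is \<open>w \<mapsto> w + 1\<close> and \<open>gen_a\<close> is
  \<open>w \<mapsto> (1 + x) w\<close>, so the lamplighter group consists of affine maps whose linear parts are powers of
  \<open>1 + x\<close>. Those linear parts commute, so commutators are translations, while the powers of \<open>1 + x\<close>
  are pairwise different; hence the abelianization is infinite. As translations commute, \<open>sigma\<close> is
  left Engel. A translation in the group by \<open>x\<^sup>2 r\<close> is \<open>(h, h)\<close>, where \<open>h\<close>, the translation by
  \<open>x r\<close>, lies in the group by self-similarity and fixes the first level; and \<open>(h, h)\<close> is a
  commutator of \<open>gen_a\<inverse>\<close> and \<open>h\<close>, because \<open>x r + (1 + x) x r = x\<^sup>2 r\<close>. So
  the coset of a translation modulo the derived subgroup of the first level stabilizer depends only on the first two coefficients.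
\<close>

section \<open>Local permutations on two letters\<close>

interpretation AutT: group AutT
  by (rule AutT_group)

text \<open>Siblings have distinct images below a common vertex, so a local permutation is injective
  on \<open>bool\<close>, hence \<open>id\<close> or \<open>Not\<close>.\<close>

lemma Gamma_eq_AutT: "Gamma = carrier AutT"
proof -
  have "\<exists>k. local_perm g v = Not ^^ k" if g: "g \<in> carrier AutT" for g v
  proof -
    have "inj (local_perm g v)"
    proof
      fix x y assume "local_perm g v x = local_perm g v y"
      then have "g (v @ [x]) = g (v @ [y])"
        using AutT_snoc[OF g, of v x] AutT_snoc[OF g, of v y] by (auto simp: local_perm_def)
      then show "x = y" using g by (auto simp: AutT_def dest: bij_is_inj injD)
    qed
    then have "local_perm g v True \<noteq> local_perm g v False" by (auto dest: injD)
    then have "local_perm g v = Not ^^ (if local_perm g v True then 0 else 1)"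
      by (auto simp: fun_eq_iff all_bool_eq)
    then show ?thesis by blast
  qed
  then show ?thesis by (auto simp: Gamma_def)
qed

section \<open>Translations\<close>

text \<open>On \<open>bool\<close>, \<open>\<noteq>\<close> is addition in the field with two
  elements. One infinite \<open>f\<close> serves words of every length.\<close>

primrec translate :: "(nat \<Rightarrow> bool) \<Rightarrow> vertex \<Rightarrow> vertex" where
  "translate f [] = []"
| "translate f (x # w) = (x \<noteq> f 0) # translate (f \<circ> Suc) w"

text \<open>Multiplication and division of a power series by \<open>1 + x\<close>.\<close>

primrec times_t :: "(nat \<Rightarrow> bool) \<Rightarrow> nat \<Rightarrow> bool" where
  "times_t f 0 = f 0"
| "times_t f (Suc i) = (f (Suc i) \<noteq> f i)"

primrec div_t :: "(nat \<Rightarrow> bool) \<Rightarrow> nat \<Rightarrow> bool" where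
  "div_t f 0 = f 0"
| "div_t f (Suc i) = (f (Suc i) \<noteq> div_t f i)"

lemma times_t_div_t [simp]: "times_t (div_t f) = f"
proof
  show "times_t (div_t f) i = f i" for i by (cases i) auto
qed

lemma length_translate [simp]: "length (translate f w) = length w"
  by (induction w arbitrary: f) auto

lemma nth_translate: "i < length w \<Longrightarrow> translate f w ! i = (w ! i \<noteq> f i)"
  by (induction w arbitrary: f i) (auto simp: nth_Cons split: nat.splits)

lemma translate_translate: "translate f (translate g w) = translate (\<lambda>i. f i \<noteq> g i) w"
  by (rule nth_equalityI) (auto simp: nth_translate)

lemma translate_comp: "translate f \<circ> translate g = translate (\<lambda>i. f i \<noteq> g i)"
  by (simp add: fun_eq_iff translate_translate)

lemma translate_zero [simp]: "translate (\<lambda>i. False) = id"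
  by (rule ext, rule nth_equalityI) (auto simp: nth_translate)

lemma translate_involutive [simp]: "translate f \<circ> translate f = id"
  by (simp add: translate_comp)

lemma sigma_eq_translate: "sigma = translate (\<lambda>i. i = 0)"
proof
  fix w
  have "translate (\<lambda>i. Suc i = 0) v = v" for v by simp
  then show "sigma w = translate (\<lambda>i. i = 0) w" by (cases w) (simp_all add: comp_def)
qed

lemma translate_AutT: "translate f \<in> carrier AutT"
proof (rule AutT_I)
  show "bij (translate f)"
    by (rule o_bij[of "translate f"]) simp_all
  show "\<exists>y. translate f (v @ [x]) = translate f v @ [y]" for v x
    by (induction v arbitrary: f) auto
qed simp

lemma inv_translate [simp]: "inv\<^bsub>AutT\<^esub> (translate f) = translate f"
  by (rule AutT.inv_equality) (simp_all add: translate_AutT)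

lemma subgroup_translations: "subgroup (range translate) AutT"
proof
  show "\<one>\<^bsub>AutT\<^esub> \<in> range translate" by (metis AutT_one rangeI translate_zero)
qed (auto simp: translate_AutT translate_comp)

text \<open>In (1 + x) w the first letter survives and is also added to the next coefficient, the
  constant term of the multiplied tail.\<close>

lemma gen_a_Cons: "gen_a (x # w) = x # translate (\<lambda>i. i = 0 \<and> x) (gen_a w)"
  by (cases x) (simp_all add: sigma_eq_translate)

text \<open>Distributivity: (1 + x)(w + f) = (1 + x) w + (1 + x) f.\<close>

lemma gen_a_translate: "gen_a (translate f w) = translate (times_t f) (gen_a w)"
proof (induction w arbitrary: f)
  case (Cons x w)
  \<comment> \<open>At 0 both sides add \<open>x\<close>, \<open>f 0\<close> and \<open>f 1\<close>;
    later both add two neighbouring coefficients of \<open>f\<close>.\<close>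
  have "((i = 0 \<and> (x \<noteq> f 0)) \<noteq> times_t (f \<circ> Suc) i)
    = ((times_t f \<circ> Suc) i \<noteq> (i = 0 \<and> x))" for i
    by (cases i) auto
  then show ?case
    by (simp only: translate.simps gen_a_Cons Cons.IH translate_translate times_t.simps)
qed simp

text \<open>1 + x is invertible among power series, so \<open>f'\<close> can be \<open>f\<close>
  divided by (1 + x)^k.\<close>

lemma translate_gen_a_power:
  "\<exists>f'. \<forall>w. translate f ((gen_a ^^ k) w) = (gen_a ^^ k) (translate f' w)"
proof (induction k arbitrary: f)
  case (Suc k)
  have "translate f (gen_a w) = gen_a (translate (div_t f) w)" for w
    by (simp add: gen_a_translate)
  then show ?case using Suc.IH[of "div_t f"] by auto
qed auto

lemma gen_a_power_translate:
  "(gen_a ^^ k) (translate f w) = translate ((times_t ^^ k) f) ((gen_a ^^ k) w)"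
  by (induction k) (auto simp: gen_a_translate)

section \<open>Uniqueness of the linear part\<close>

lemma gen_a_zero: "gen_a (replicate n False) = replicate n False"
  by (induction n) auto

lemma gen_a_power_zero: "(gen_a ^^ k) (replicate n False) = replicate n False"
  by (induction k) (auto simp: gen_a_zero)

text \<open>At a series h the two sides are f + (1 + x)^k h and g + (1 + x)^l h. Taking h = 0 gives
  f = g; then h = 1 compares two powers of 1 + x, which differ in degree.\<close>

lemma affine_slope_unique:
  assumes "translate f \<circ> gen_a ^^ k = translate g \<circ> gen_a ^^ l"
  shows "k = l"
proof -
  \<comment> \<open>\<open>\<lambda>i. i = 0\<close> is the series 1, so this says that (1 + x)^k
    has degree \<open>k\<close>.\<close>
  have deg: "(times_t ^^ k) (\<lambda>i. i = 0) i = (i = k)" if "k \<le> i" for i k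
    using that
  proof (induction k arbitrary: i)
    case (Suc k)
    then obtain j where "i = Suc j" "k \<le> j" by (auto dest: Suc_le_D)
    then show ?case using Suc.IH[of j] Suc.IH[of "Suc j"] by auto
  qed simp
  have coeff: "(f i \<noteq> (times_t ^^ k) h i) = (g i \<noteq> (times_t ^^ l) h i)" for h i
  proof -
    have "translate f ((gen_a ^^ k) (translate h v)) = translate g ((gen_a ^^ l) (translate h v))"
      for v using assms by (metis comp_apply)
    \<comment> \<open>A truncation of \<open>h\<close> is \<open>h\<close> added to the zero word,
      which \<open>gen_a\<close> fixes; length \<open>Suc i\<close> makes coefficient
      \<open>i\<close> visible.\<close>
    moreover have "(gen_a ^^ k) (translate h (replicate (Suc i) False))
      = translate ((times_t ^^ k) h) (replicate (Suc i) False)" for k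
      by (simp only: gen_a_power_translate gen_a_power_zero)
    ultimately have "translate f (translate ((times_t ^^ k) h) (replicate (Suc i) False)) ! i
      = translate g (translate ((times_t ^^ l) h) (replicate (Suc i) False)) ! i"
      by metis
    then show ?thesis by (simp add: translate_translate nth_translate del: replicate_Suc)
  qed
  have zero: "(times_t ^^ k) (\<lambda>i. False) = (\<lambda>i. False)" for k
  proof (induction k)
    case (Suc k)
    have "times_t (\<lambda>i. False) = (\<lambda>i. False)"
    proof
      show "times_t (\<lambda>i. False) i = False" for i by (cases i) auto
    qed
    then show ?case using Suc by simp
  qed simp
  have "f i = g i" for i
    using coeff[of i "\<lambda>i. False"] by (simp add: zero)
  then have "(times_t ^^ k) (\<lambda>i. i = 0) i = (times_t ^^ l) (\<lambda>i. i = 0) i" for i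
    using coeff[of i] by auto
  then show "k = l" using deg by (metis nat_le_linear)
qed

section \<open>The derived subgroup of the lamplighter group\<close>

lemma gen_a_in_lamplighter: "gen_a \<in> lamplighter"
  by (simp add: lamplighter_def generate.incl)

lemma sigma_in_lamplighter: "sigma \<in> lamplighter"
  by (simp add: lamplighter_def generate.incl)

lemma lamplighter_carrier: "lamplighter \<subseteq> carrier AutT"
  using lamplighter_subgroup by (rule subgroup.subset)

lemma lamplighter_comp: "g \<in> lamplighter \<Longrightarrow> h \<in> lamplighter \<Longrightarrow> g \<circ> h \<in> lamplighter"
  using subgroup.m_closed[OF lamplighter_subgroup, of h g] by simp

lemma gen_a_power_in_lamplighter: "gen_a ^^ k \<in> lamplighter"
  using subgroup.one_closed[OF lamplighter_subgroup]
  by (induction k) (auto intro: lamplighter_comp gen_a_in_lamplighter)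

section \<open>Linear parts of group elements\<close>

lemma inv_comp_AutT:
  assumes "g \<in> carrier AutT"
  shows "inv\<^bsub>AutT\<^esub> g \<circ> g = id" "g \<circ> inv\<^bsub>AutT\<^esub> g = id"
  using AutT.r_inv[OF assms] AutT.l_inv[OF assms] by simp_all

text \<open>Negative exponents are avoided: the linear part of \<open>g\<close> is \<open>gen_a\<close> to the power \<open>n - m\<close>.\<close>

definition has_slope :: "(vertex \<Rightarrow> vertex) \<Rightarrow> nat \<Rightarrow> nat \<Rightarrow> bool" where
  "has_slope g m n \<longleftrightarrow> (\<exists>f. \<forall>w. g ((gen_a ^^ m) w) = (gen_a ^^ n) (translate f w))"

text \<open>Powers of \<open>gen_a\<close> commute, and translations can be pushed through them to
  the right, so exponents add.\<close>

lemma has_slope_comp: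
  assumes "has_slope g m n" "has_slope h m' n'"
  shows "has_slope (g \<circ> h) (m + m') (n + n')"
proof -
  obtain f f' where f: "\<And>w. g ((gen_a ^^ m) w) = (gen_a ^^ n) (translate f w)"
    and f': "\<And>w. h ((gen_a ^^ m') w) = (gen_a ^^ n') (translate f' w)"
    using assms unfolding has_slope_def by blast
  obtain k where k: "\<And>w. translate f' ((gen_a ^^ m) w) = (gen_a ^^ m) (translate k w)"
    using translate_gen_a_power by blast
  obtain k' where k': "\<And>w. translate f ((gen_a ^^ n') w) = (gen_a ^^ n') (translate k' w)"
    using translate_gen_a_power by blast
  have comm: "(gen_a ^^ i) ((gen_a ^^ j) w) = (gen_a ^^ j) ((gen_a ^^ i) w)" for i j w
    by (metis add.commute comp_apply funpow_add)
  have "(g \<circ> h) ((gen_a ^^ (m + m')) w) = (gen_a ^^ (n + n')) (translate (\<lambda>i. k' i \<noteq> k i) w)"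
    for w
  proof -
    have "(g \<circ> h) ((gen_a ^^ (m + m')) w) = g (h ((gen_a ^^ m') ((gen_a ^^ m) w)))"
      by (simp add: funpow_add comm)
    also have "\<dots> = g ((gen_a ^^ m) ((gen_a ^^ n') (translate k w)))"
      by (simp only: f' k comm[of m n'])
    also have "\<dots> = (gen_a ^^ (n + n')) (translate (\<lambda>i. k' i \<noteq> k i) w)"
      by (simp only: f k' translate_translate funpow_add comp_apply)
    finally show ?thesis .
  qed
  then show ?thesis unfolding has_slope_def by blast
qed

lemma lamplighter_has_slope: "g \<in> lamplighter \<Longrightarrow> \<exists>m n. has_slope g m n"
  unfolding lamplighter_def
proof (induction rule: generate.induct)
  case one
  have "id ((gen_a ^^ 0) w) = (gen_a ^^ 0) (translate (\<lambda>i. False) w)" for w by simp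
  then show ?case unfolding has_slope_def AutT_one by blast
next
  \<comment> \<open>These facts serve both generators and their inverses: \<open>sigma\<close> is
    its own inverse, and inverting \<open>gen_a\<close> swaps its exponents.\<close>
  have s: "has_slope sigma 0 0"
    unfolding has_slope_def by (auto simp: sigma_eq_translate)
  have "gen_a ((gen_a ^^ 0) w) = (gen_a ^^ 1) (translate (\<lambda>i. False) w)" for w
    by simp
  then have a: "has_slope gen_a 0 1"
    unfolding has_slope_def by blast
  have "(inv\<^bsub>AutT\<^esub> gen_a) ((gen_a ^^ 1) w) = (gen_a ^^ 0) (translate (\<lambda>i. False) w)" for w
    using fun_cong[OF inv_comp_AutT(1)[OF gen_a_AutT], of w] by simp
  then have a': "has_slope (inv\<^bsub>AutT\<^esub> gen_a) 1 0"
    unfolding has_slope_def by blast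
  {
    case (incl h)
    then show ?case using s a by blast
  next
    case (inv h)
    moreover have "inv\<^bsub>AutT\<^esub> sigma = sigma" by (simp add: sigma_eq_translate)
    ultimately show ?case using s a' by (metis empty_iff insert_iff)
  }
next
  case (eng h1 h2)
  then show ?case using has_slope_comp unfolding AutT_mult by blast
qed

text \<open>Linear parts commute, so the two products have the same one and differ only by a
  translation.\<close>

lemma lamplighter_commute:
  assumes g: "g \<in> lamplighter" and h: "h \<in> lamplighter"
  shows "\<exists>f. g \<circ> h = h \<circ> g \<circ> translate f"
proof -
  obtain m n m' n' where "has_slope g m n" "has_slope h m' n'"
    using lamplighter_has_slope g h by blast
  then have "has_slope (g \<circ> h) (m + m') (n + n')" "has_slope (h \<circ> g) (m + m') (n + n')"
    using has_slope_comp by (blast, metis add.commute has_slope_comp)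
  then obtain f f' where f: "\<And>w. (g \<circ> h) ((gen_a ^^ (m + m')) w) = (gen_a ^^ (n + n')) (translate f w)"
    and f': "\<And>w. (h \<circ> g) ((gen_a ^^ (m + m')) w) = (gen_a ^^ (n + n')) (translate f' w)"
    unfolding has_slope_def by blast
  \<comment> \<open>\<open>?k\<close> is the difference of the translation parts in characteristic
    2; multiplied by (1 + x)^(m + m') it acts on \<open>v\<close> rather than on its preimage
    \<open>w\<close>.\<close>
  let ?k = "\<lambda>i. f' i \<noteq> f i"
  let ?k' = "(times_t ^^ (m + m')) ?k"
  have "g \<circ> h = h \<circ> g \<circ> translate ?k'"
  proof
    fix v
    have "surj (gen_a ^^ (m + m'))"
      using gen_a_AutT by (auto simp: AutT_def bij_is_surj intro: surj_fn)
    then obtain w where w: "v = (gen_a ^^ (m + m')) w" by (rule surjE)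
    have "translate f w = translate f' (translate ?k w)"
      unfolding translate_translate by (rule arg_cong[of _ _ "\<lambda>f. translate f w"]) auto
    then have "(g \<circ> h) v = (h \<circ> g) ((gen_a ^^ (m + m')) (translate ?k w))"
      by (simp only: w f f')
    also have "\<dots> = (h \<circ> g) (translate ?k' v)"
      by (simp only: w gen_a_power_translate)
    finally show "(g \<circ> h) v = (h \<circ> g \<circ> translate ?k') v" by simp
  qed
  then show ?thesis by blast
qed

lemma commutator_translate:
  assumes g: "g \<in> lamplighter" and h: "h \<in> lamplighter"
  shows "g \<otimes>\<^bsub>AutT\<^esub> h \<otimes>\<^bsub>AutT\<^esub> inv\<^bsub>AutT\<^esub> g \<otimes>\<^bsub>AutT\<^esub> inv\<^bsub>AutT\<^esub> h \<in> range translate"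
proof -
  note [simp del] = AutT_mult AutT_one
  have c: "g \<in> carrier AutT" "h \<in> carrier AutT" using assms lamplighter_carrier by auto
  \<comment> \<open>The left factor in \<open>AutT\<close> is applied first, hence the exchanged
    roles of \<open>g\<close> and \<open>h\<close>.\<close>
  obtain f where "g \<otimes>\<^bsub>AutT\<^esub> h = translate f \<otimes>\<^bsub>AutT\<^esub> (h \<otimes>\<^bsub>AutT\<^esub> g)"
    using lamplighter_commute[OF h g] unfolding AutT_mult by blast
  then have "g \<otimes>\<^bsub>AutT\<^esub> h \<otimes>\<^bsub>AutT\<^esub> inv\<^bsub>AutT\<^esub> g \<otimes>\<^bsub>AutT\<^esub> inv\<^bsub>AutT\<^esub> h = translate f"
    using c translate_AutT[of f] by (simp add: AutT.m_assoc AutT.inv_solve_right')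
  then show ?thesis by blast
qed

section \<open>Derived subgroup and infinite abelianization\<close>

lemma derived_lamplighter_translate: "derived AutT lamplighter \<subseteq> range translate"
  unfolding derived_def
  by (rule AutT.generate_subgroup_incl[OF _ subgroup_translations])
    (auto simp del: AutT_mult intro: commutator_translate)

lemma derived_lamplighter_subset: "derived AutT lamplighter \<subseteq> lamplighter"
  by (rule AutT.derived_incl[OF order.refl lamplighter_subgroup])

text \<open>Translations leave the linear part alone, so distinct powers of \<open>gen_a\<close>
  represent distinct cosets.\<close>

lemma infinite_abelianization:
  "infinite (rcosets\<^bsub>AutT\<lparr>carrier := lamplighter\<rparr>\<^esub> (derived AutT lamplighter))"
proof -
  let ?D = "derived AutT lamplighter"
  let ?c = "\<lambda>k. ?D #>\<^bsub>AutT\<lparr>carrier := lamplighter\<rparr>\<^esub> (gen_a ^^ k)"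
  have "inj ?c"
  proof
    fix k l assume "?c k = ?c l"
    moreover have "id \<in> ?D" using generate.one[of AutT] by (simp add: derived_def)
    then have "gen_a ^^ k \<in> ?c k" by (auto simp: r_coset_def intro!: bexI[of _ id])
    ultimately obtain d where "d \<in> ?D" "gen_a ^^ k = gen_a ^^ l \<circ> d"
      by (auto simp: r_coset_def)
    then obtain f where "gen_a ^^ k = gen_a ^^ l \<circ> translate f"
      using derived_lamplighter_translate by blast
    then have "translate (\<lambda>i. False) \<circ> gen_a ^^ k = translate ((times_t ^^ l) f) \<circ> gen_a ^^ l"
      by (simp add: fun_eq_iff gen_a_power_translate)
    then show "k = l" by (rule affine_slope_unique)
  qed
  moreover have "range ?c \<subseteq> rcosets\<^bsub>AutT\<lparr>carrier := lamplighter\<rparr>\<^esub> ?D"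
    using gen_a_power_in_lamplighter by (auto simp: RCOSETS_def)
  ultimately show ?thesis
    by (meson finite_imageD finite_subset infinite_UNIV_nat)
qed

section \<open>Self-similarity\<close>

lemma AutT_sect_at: "g \<in> carrier AutT \<Longrightarrow> g (x # w) = g [x] @ sect_at g [x] w"
  using AutT_append[of g "[x]" w] by simp

lemma AutT_level1:
  assumes "g \<in> carrier AutT"
  obtains y where "g [x] = [y]"
  using AutT_length[OF assms, of "[x]"] by (auto simp: length_Suc_conv)

text \<open>Chain rule: \<open>g\<close> carries the subtree below \<open>[x]\<close> to the one
  below \<open>g [x]\<close>, and there \<open>h\<close> acts next.\<close>

lemma sect_at_comp:
  assumes "g \<in> carrier AutT" "h \<in> carrier AutT"
  shows "sect_at (h \<circ> g) [x] = sect_at h (g [x]) \<circ> sect_at g [x]"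
proof -
  obtain y where y: "g [x] = [y]" by (rule AutT_level1[OF assms(1)])
  obtain z where z: "h [y] = [z]" by (rule AutT_level1[OF assms(2)])
  have "h (g (x # w)) = [z] @ sect_at h [y] (sect_at g [x] w)" for w
    using AutT_sect_at[OF assms(1), of x w] AutT_sect_at[OF assms(2), of y] y z by simp
  then have "sect_at (h \<circ> g) [x] w = sect_at h [y] (sect_at g [x] w)" for w
    by (simp add: sect_at_def[of "h \<circ> g"])
  then show ?thesis by (simp add: fun_eq_iff y)
qed

lemma sect_at_sigma [simp]: "sect_at sigma [x] = id"
  by (simp add: fun_eq_iff sect_at_def)

lemma sect_at_id [simp]: "sect_at id v = id"
  by (simp add: fun_eq_iff sect_at_def)

lemma sect_at_gen_a: "sect_at gen_a [x] = (if x then sigma \<circ> gen_a else gen_a)"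
  by (simp add: fun_eq_iff sect_at_def)

lemma sect_at_inv:
  assumes g: "g \<in> carrier AutT" and s: "\<And>y. sect_at g [y] \<in> carrier AutT"
  shows "\<exists>y. sect_at (inv\<^bsub>AutT\<^esub> g) [x] = inv\<^bsub>AutT\<^esub> (sect_at g [y])"
proof -
  have i: "inv\<^bsub>AutT\<^esub> g \<in> carrier AutT" using g by simp
  obtain y where y: "(inv\<^bsub>AutT\<^esub> g) [x] = [y]" by (rule AutT_level1[OF i])
  have "sect_at g [y] \<circ> sect_at (inv\<^bsub>AutT\<^esub> g) [x] = id"
    using sect_at_comp[OF i g, of x] y by (simp add: inv_comp_AutT g)
  then have "inv\<^bsub>AutT\<^esub> (sect_at g [y]) \<circ> sect_at g [y] \<circ> sect_at (inv\<^bsub>AutT\<^esub> g) [x]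
    = inv\<^bsub>AutT\<^esub> (sect_at g [y])"
    by (simp add: comp_assoc)
  then have "sect_at (inv\<^bsub>AutT\<^esub> g) [x] = inv\<^bsub>AutT\<^esub> (sect_at g [y])" by (simp add: inv_comp_AutT s)
  then show ?thesis by blast
qed

text \<open>By the chain rule, the automorphisms whose first-level sections lie in the group form a
  subgroup \<open>?S\<close>, which contains both generators.\<close>

lemma sect_at_lamplighter: "g \<in> lamplighter \<Longrightarrow> sect_at g [x] \<in> lamplighter"
proof -
  let ?S = "{g \<in> carrier AutT. \<forall>x. sect_at g [x] \<in> lamplighter}"
  have "subgroup ?S AutT"
  proof
    show "\<one>\<^bsub>AutT\<^esub> \<in> ?S"
      using subgroup.one_closed[OF lamplighter_subgroup] AutT.one_closed by simp
  next
    fix g h assume gh: "g \<in> ?S" "h \<in> ?S"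
    then have c: "g \<in> carrier AutT" by simp
    have "sect_at (h \<circ> g) [x] \<in> lamplighter" for x
    proof -
      obtain y where "g [x] = [y]" by (rule AutT_level1[OF c])
      then show ?thesis using gh by (simp add: sect_at_comp lamplighter_comp)
    qed
    moreover have "g \<otimes>\<^bsub>AutT\<^esub> h \<in> carrier AutT" using gh by (intro AutT.m_closed) auto
    ultimately show "g \<otimes>\<^bsub>AutT\<^esub> h \<in> ?S" by simp
  next
    fix g assume g: "g \<in> ?S"
    then have "sect_at g [y] \<in> carrier AutT" for y using lamplighter_carrier by blast
    then have *: "\<exists>y. sect_at (inv\<^bsub>AutT\<^esub> g) [x] = inv\<^bsub>AutT\<^esub> (sect_at g [y])" for x
      using sect_at_inv[of g x] g by blast
    then have "sect_at (inv\<^bsub>AutT\<^esub> g) [x] \<in> lamplighter" for x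
    proof -
      obtain y where "sect_at (inv\<^bsub>AutT\<^esub> g) [x] = inv\<^bsub>AutT\<^esub> (sect_at g [y])"
        using * by blast
      then show ?thesis using g subgroup.m_inv_closed[OF lamplighter_subgroup] by simp
    qed
    then show "inv\<^bsub>AutT\<^esub> g \<in> ?S" using g by simp
  qed auto
  moreover have "{gen_a, sigma} \<subseteq> ?S"
    using gen_a_in_lamplighter sigma_in_lamplighter subgroup.one_closed[OF lamplighter_subgroup]
    by (auto simp: gen_a_AutT sigma_AutT sect_at_gen_a lamplighter_comp)
  ultimately have "lamplighter \<subseteq> ?S"
    unfolding lamplighter_def by (intro AutT.generate_subgroup_incl)
  then show "g \<in> lamplighter \<Longrightarrow> sect_at g [x] \<in> lamplighter" by blast
qed

lemma self_similar_lamplighter: "self_similar lamplighter"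
  unfolding self_similar_def
proof (intro conjI ballI impI)
  fix g g0 \<tau>
  assume "g \<in> lamplighter" and g0: "g0 \<in> st1" and \<tau>: "\<tau> \<in> {\<one>\<^bsub>AutT\<^esub>, sigma}"
    and "g = g0 \<otimes>\<^bsub>AutT\<^esub> \<tau>"
  then have "sect_at (\<tau> \<circ> g0) [x] \<in> lamplighter" for x
    by (auto intro: sect_at_lamplighter)
  \<comment> \<open>\<open>id\<close> and \<open>sigma\<close> have trivial first-level
    sections.\<close>
  moreover have "sect_at (\<tau> \<circ> g0) [x] = sect_at g0 [x]" for x
  proof -
    have A: "g0 \<in> carrier AutT" "\<tau> \<in> carrier AutT"
      using g0 \<tau> sigma_AutT AutT.one_closed by (auto simp: st1_def)
    obtain y where "g0 [x] = [y]" by (rule AutT_level1[OF A(1)])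
    then show ?thesis using A \<tau> by (auto simp: sect_at_comp)
  qed
  ultimately show "psi g0 \<in> lamplighter \<times> lamplighter"
    by (simp add: psi_def)
qed (rule lamplighter_subgroup)

lemma st1_fix: "g \<in> st1 \<Longrightarrow> g [x] = [x]"
  by (cases x) (auto simp: st1_def)

text \<open>\<open>gen_a\<close> is (a, a sigma) and its conjugate by \<open>sigma\<close> is (a
  sigma, a), so each coordinate takes the values a and a sigma, which generate the group.\<close>

lemma st1_lamplighter_sect_at: "(\<lambda>g. sect_at g [x]) ` (st1 \<inter> lamplighter) = lamplighter"
proof
  let ?I = "(\<lambda>g. sect_at g [x]) ` (st1 \<inter> lamplighter)"
  have sub: "subgroup st1 AutT"
  proof
    fix g assume g: "g \<in> st1"
    then have c: "g \<in> carrier AutT" by (simp add: st1_def)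
    have "(inv\<^bsub>AutT\<^esub> g) [y] = [y]" for y
      using fun_cong[OF inv_comp_AutT(1)[OF c], of "[y]"] st1_fix[OF g] by simp
    then show "inv\<^bsub>AutT\<^esub> g \<in> st1" using c by (simp add: st1_def)
  next
    fix g h assume "g \<in> st1" "h \<in> st1"
    then show "g \<otimes>\<^bsub>AutT\<^esub> h \<in> st1"
      using AutT.m_closed[of g h] by (simp add: st1_def)
  qed (use AutT.one_closed in \<open>auto simp: st1_def\<close>)
  then have st: "subgroup (st1 \<inter> lamplighter) AutT"
    by (intro AutT.subgroups_Inter_pair lamplighter_subgroup)
  \<comment> \<open>As \<open>st1\<close> fixes \<open>[x]\<close>, the chain rule becomes
    multiplicativity, so \<open>?I\<close> is a subgroup.\<close>
  have mult: "sect_at (g \<otimes>\<^bsub>AutT\<^esub> h) [x] = sect_at g [x] \<otimes>\<^bsub>AutT\<^esub> sect_at h [x]"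
    if "g \<in> st1" "h \<in> st1" for g h
    using that sect_at_comp[of g h x] st1_fix[of g x] by (simp add: st1_def)
  have "(\<lambda>g. sect_at g [x]) \<in> hom (AutT\<lparr>carrier := st1 \<inter> lamplighter\<rparr>) AutT"
    using mult sect_at_lamplighter lamplighter_carrier by (auto simp: hom_def)
  then have "group_hom (AutT\<lparr>carrier := st1 \<inter> lamplighter\<rparr>) AutT (\<lambda>g. sect_at g [x])"
    using AutT.subgroup_imp_group[OF st] AutT_group
    by (auto simp: group_hom_def group_hom_axioms_def)
  then have I: "subgroup ?I AutT"
    using group_hom.img_is_subgroup by fastforce
  have a: "gen_a \<in> st1 \<inter> lamplighter" using gen_a_st1 gen_a_in_lamplighter by simp
  let ?b = "sigma \<circ> gen_a \<circ> sigma"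
  have b: "?b \<in> st1 \<inter> lamplighter"
    using gen_a_in_lamplighter sigma_in_lamplighter lamplighter_carrier
    by (auto simp: st1_def lamplighter_comp)
  have sb: "sect_at ?b [x] = sect_at gen_a [\<not> x]"
    by (cases x) (simp_all add: fun_eq_iff sect_at_def)
  have "sect_at gen_a [x] \<in> ?I" "sect_at ?b [x] \<in> ?I"
    by (intro imageI a b)+
  then have gens: "gen_a \<in> ?I" "sigma \<circ> gen_a \<in> ?I"
    unfolding sb sect_at_gen_a by (cases x; simp)+
  have "sigma = sigma \<circ> gen_a \<circ> inv\<^bsub>AutT\<^esub> gen_a"
    by (simp add: comp_assoc inv_comp_AutT gen_a_AutT)
  then have "sigma = inv\<^bsub>AutT\<^esub> gen_a \<otimes>\<^bsub>AutT\<^esub> (sigma \<circ> gen_a)" by simp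
  also have "\<dots> \<in> ?I"
    using gens subgroup.m_closed[OF I] subgroup.m_inv_closed[OF I] by blast
  finally have "{gen_a, sigma} \<subseteq> ?I" using gens by blast
  then have "generate AutT {gen_a, sigma} \<subseteq> ?I"
    by (rule AutT.generate_subgroup_incl[OF _ I])
  then show "lamplighter \<subseteq> ?I" by (simp only: lamplighter_def)
qed (auto intro: sect_at_lamplighter)

lemma fractal_lamplighter: "fractal lamplighter"
  unfolding fractal_def using self_similar_lamplighter st1_lamplighter_sect_at
  by (simp add: image_image psi_def)

section \<open>The derived subgroup of the first level stabilizer\<close>

lemma translate_in_derived_st1:
  assumes L: "translate f \<in> lamplighter" and f: "\<not> f 0" "\<not> f 1"
  shows "translate f \<in> derived AutT (st1 \<inter> lamplighter)"
proof -
  \<comment> \<open>As \<open>f 0\<close> vanishes, \<open>f \<circ> Suc\<close> is \<open>f\<close>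
    divided by x; as \<open>f 1\<close> vanishes, \<open>?h\<close> fixes the first level.\<close>
  let ?h = "translate (f \<circ> Suc)"
  have "sect_at (translate f) [False] = ?h"
    by (simp add: fun_eq_iff sect_at_def)
  then have "?h \<in> lamplighter" using sect_at_lamplighter[OF L, of False] by simp
  then have h: "?h \<in> st1 \<inter> lamplighter"
    using f by (simp add: st1_def translate_AutT)
  have "inv\<^bsub>AutT\<^esub> gen_a \<in> lamplighter"
    using subgroup.m_inv_closed[OF lamplighter_subgroup] gen_a_in_lamplighter by blast
  moreover have "(inv\<^bsub>AutT\<^esub> gen_a) [x] = [x]" for x
    using fun_cong[OF inv_comp_AutT(1)[OF gen_a_AutT], of "[x]"] st1_fix[OF gen_a_st1] by simp
  ultimately have a: "inv\<^bsub>AutT\<^esub> gen_a \<in> st1 \<inter> lamplighter"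
    by (simp add: st1_def gen_a_AutT)
  \<comment> \<open>With h = \<open>f \<circ> Suc\<close> this is x h = h + (1 + x) h.\<close>
  have "f = (\<lambda>i. (f \<circ> Suc) i \<noteq> times_t (f \<circ> Suc) i)"
  proof
    show "f i = ((f \<circ> Suc) i \<noteq> times_t (f \<circ> Suc) i)" for i
      using f by (cases i) auto
  qed
  then have "translate f = ?h \<circ> translate (times_t (f \<circ> Suc))"
    by (simp only: translate_comp)
  also have "\<dots> = ?h \<circ> (translate (times_t (f \<circ> Suc)) \<circ> gen_a) \<circ> inv\<^bsub>AutT\<^esub> gen_a"
    by (simp add: comp_assoc inv_comp_AutT gen_a_AutT)
  also have "translate (times_t (f \<circ> Suc)) \<circ> gen_a = gen_a \<circ> ?h"
    by (simp add: fun_eq_iff gen_a_translate)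
  \<comment> \<open>Read from left to right in \<open>AutT\<close> this is a commutator in the form
    used by \<open>derived\<close>; the last factor \<open>?h\<close> is its own inverse.\<close>
  also have "?h \<circ> (gen_a \<circ> ?h) \<circ> inv\<^bsub>AutT\<^esub> gen_a
    = inv\<^bsub>AutT\<^esub> gen_a \<otimes>\<^bsub>AutT\<^esub> ?h \<otimes>\<^bsub>AutT\<^esub> inv\<^bsub>AutT\<^esub> (inv\<^bsub>AutT\<^esub> gen_a) \<otimes>\<^bsub>AutT\<^esub> inv\<^bsub>AutT\<^esub> ?h"
    by (simp add: comp_assoc gen_a_AutT)
  also have "\<dots> \<in> derived AutT (st1 \<inter> lamplighter)"
    unfolding derived_def using a h by (intro generate.incl) blast
  finally show ?thesis .
qed

lemma finite_index_derived_st1: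
  "finite (rcosets\<^bsub>AutT\<lparr>carrier := derived AutT lamplighter\<rparr>\<^esub> (derived AutT (st1 \<inter> lamplighter)))"
proof -
  let ?D = "derived AutT lamplighter" and ?S = "derived AutT (st1 \<inter> lamplighter)"
  \<comment> \<open>On a translation, \<open>?v\<close> reads off the first two
    coefficients.\<close>
  let ?v = "\<lambda>g :: vertex \<Rightarrow> vertex. g [False, False]"
  have DA: "?D \<subseteq> carrier AutT"
    using derived_lamplighter_subset lamplighter_carrier by blast
  have S: "subgroup ?S AutT"
    using lamplighter_carrier by (intro AutT.derived_is_subgroup) blast
  have coset: "?S #>\<^bsub>AutT\<^esub> g = ?S #>\<^bsub>AutT\<^esub> h" if g: "g \<in> ?D" and h: "h \<in> ?D" and v: "?v g = ?v h"
    for g h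
  proof -
    obtain e f where e: "g = translate e" and f: "h = translate f"
      using g h derived_lamplighter_translate by blast
    have "g \<in> lamplighter" "h \<in> lamplighter" using g h derived_lamplighter_subset by auto
    then have "translate (\<lambda>i. f i \<noteq> e i) \<in> lamplighter"
      unfolding e f translate_comp[symmetric] by (intro lamplighter_comp)
    \<comment> \<open>Equal values of \<open>?v\<close> make the first two coefficients of the sum
      cancel.\<close>
    then have "translate (\<lambda>i. f i \<noteq> e i) \<in> ?S"
      using v unfolding e f by (intro translate_in_derived_st1) auto
    moreover have "g \<otimes>\<^bsub>AutT\<^esub> inv\<^bsub>AutT\<^esub> h = translate (\<lambda>i. f i \<noteq> e i)"
      unfolding e f by (simp add: translate_comp)
    ultimately have "g \<otimes>\<^bsub>AutT\<^esub> inv\<^bsub>AutT\<^esub> h \<in> ?S" by (simp only:)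
    then have "?S #>\<^bsub>AutT\<^esub> (g \<otimes>\<^bsub>AutT\<^esub> inv\<^bsub>AutT\<^esub> h) = ?S"
      using S subgroup.mem_carrier[OF S] by (intro AutT.coset_join2)
    then show ?thesis
      using g h DA subgroup.subset[OF S] by (intro AutT.coset_mult_inv1) auto
  qed
  have "?v ` ?D \<subseteq> {w. set w \<subseteq> UNIV \<and> length w = 2}"
  proof (rule image_subsetI)
    fix g assume "g \<in> ?D"
    then have "length (g [False, False]) = length [False, False]"
      using DA by (intro AutT_length) blast
    then show "?v g \<in> {w. set w \<subseteq> UNIV \<and> length w = 2}" by simp
  qed
  then have "finite (?v ` ?D)"
    by (rule finite_subset) (rule finite_lists_length_eq, simp)
  \<comment> \<open>By \<open>coset\<close>, one representative for each value of \<open>?v\<close>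
    suffices.\<close>
  moreover have "(\<lambda>g. ?S #>\<^bsub>AutT\<^esub> g) ` ?D \<subseteq> (\<lambda>w. ?S #>\<^bsub>AutT\<^esub> inv_into ?D ?v w) ` (?v ` ?D)"
  proof (rule image_subsetI)
    fix g assume g: "g \<in> ?D"
    then have v: "?v g \<in> ?v ` ?D" by blast
    have "?S #>\<^bsub>AutT\<^esub> g = ?S #>\<^bsub>AutT\<^esub> inv_into ?D ?v (?v g)"
      using g v by (intro coset inv_into_into f_inv_into_f[OF v, symmetric])
    then show "?S #>\<^bsub>AutT\<^esub> g \<in> (\<lambda>w. ?S #>\<^bsub>AutT\<^esub> inv_into ?D ?v w) ` (?v ` ?D)"
      using g by blast
  qed
  ultimately have "finite ((\<lambda>g. ?S #>\<^bsub>AutT\<^esub> g) ` ?D)"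
    by (meson finite_imageI finite_subset)
  moreover have "rcosets\<^bsub>AutT\<lparr>carrier := ?D\<rparr>\<^esub> ?S = (\<lambda>g. ?S #>\<^bsub>AutT\<^esub> g) ` ?D"
    by (auto simp: RCOSETS_def r_coset_def)
  ultimately show ?thesis by simp
qed

section \<open>Engel elements\<close>

text \<open>The first commutator with \<open>sigma\<close> is a translation and the second is
  trivial, so length 2 works for every element.\<close>

lemma sigma_left_engel: "sigma \<in> left_engel (AutT\<lparr>carrier := lamplighter\<rparr>)"
proof -
  let ?L = "AutT\<lparr>carrier := lamplighter\<rparr>"
  have inv_L: "inv\<^bsub>?L\<^esub> g = inv\<^bsub>AutT\<^esub> g" if "g \<in> lamplighter" for g
    using that by (rule AutT.m_inv_consistent[OF lamplighter_subgroup])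
  have inv_s: "inv\<^bsub>AutT\<^esub> sigma = sigma" by (simp add: sigma_eq_translate)
  have comm: "commutator ?L g sigma = inv\<^bsub>AutT\<^esub> g \<otimes>\<^bsub>AutT\<^esub> sigma \<otimes>\<^bsub>AutT\<^esub> g \<otimes>\<^bsub>AutT\<^esub> sigma"
    if "g \<in> lamplighter" for g
    using that by (simp add: commutator_def inv_L sigma_in_lamplighter inv_s)
  have "engel_comm ?L x sigma 2 = \<one>\<^bsub>?L\<^esub>" if x: "x \<in> lamplighter" for x
  proof -
    have ix: "inv\<^bsub>AutT\<^esub> x \<in> lamplighter"
      using x subgroup.m_inv_closed[OF lamplighter_subgroup] by blast
    \<comment> \<open>Replacing \<open>x\<close> by its inverse passes between the two commutator
      conventions, as \<open>sigma\<close> is an involution.\<close>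
    have "commutator ?L x sigma \<in> range translate"
      using commutator_translate[OF ix sigma_in_lamplighter] x lamplighter_carrier
      by (simp add: comm inv_s subset_iff del: AutT_mult)
    then obtain f where f: "commutator ?L x sigma = translate f" by blast
    have "commutator ?L x sigma \<in> lamplighter"
      using x ix sigma_in_lamplighter by (simp add: comm lamplighter_comp)
    then have "commutator ?L (translate f) sigma
      = translate (\<lambda>i. (i = 0) \<noteq> (f i \<noteq> ((i = 0) \<noteq> f i)))"
      unfolding f using comm
      by (simp only: inv_translate AutT_mult sigma_eq_translate translate_comp)
    \<comment> \<open>Both the series 1 and \<open>f\<close> are added twice.\<close>
    also have "(\<lambda>i. (i = 0) \<noteq> (f i \<noteq> ((i = 0) \<noteq> f i))) = (\<lambda>i. False)" by auto
    finally have "commutator ?L (translate f) sigma = id" by (simp only: translate_zero)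
    then show ?thesis by (simp only: numeral_2_eq_2 engel_comm.simps f) simp
  qed
  then show ?thesis
    unfolding left_engel_def using sigma_in_lamplighter by (auto intro!: exI[of _ 2])
qed

theorem proposition12:
  shows "subgroup lamplighter (AutT\<lparr>carrier := Gamma\<rparr>) \<and> Gamma = carrier AutT
    \<and> infinite (rcosets\<^bsub>AutT\<lparr>carrier := lamplighter\<rparr>\<^esub> (derived AutT lamplighter))
    \<and> fractal lamplighter
    \<and> finite (rcosets\<^bsub>AutT\<lparr>carrier := derived AutT lamplighter\<rparr>\<^esub> (derived AutT (st1 \<inter> lamplighter)))
    \<and> left_engel (AutT\<lparr>carrier := lamplighter\<rparr>) \<noteq> {\<one>\<^bsub>AutT\<^esub>}"
proof (intro conjI)
  show "subgroup lamplighter (AutT\<lparr>carrier := Gamma\<rparr>)"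
    by (simp add: Gamma_eq_AutT lamplighter_subgroup)
  have "sigma [True] \<noteq> id [True]" by simp
  then have "sigma \<noteq> \<one>\<^bsub>AutT\<^esub>" by (metis AutT_one)
  then show "left_engel (AutT\<lparr>carrier := lamplighter\<rparr>) \<noteq> {\<one>\<^bsub>AutT\<^esub>}"
    using sigma_left_engel by blast
qed (rule Gamma_eq_AutT infinite_abelianization fractal_lamplighter finite_index_derived_st1)+

end
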